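(* For $n=11563=31\times 373$ the Kurepa determinant satisfies $K_{11563}\equiv 0\pmod{11563}$. In particular, there exists an odd composite integer $n\ge 9$ with $K_n\equiv 0\pmod n$.
   Context: For an integer $N\ge 7$ let $m=N-4$ and let $M_N=(a_{ij})_{1\le i,j\le m}$ be the integer matrix with entries: row $1$: $a_{1j}=1$ for $1\le j\le m-1$ and $a_{1m}=3$; for $2\le i\le m-1$: $a_{ij}=0$ if $j<i-2$, $a_{i,i-2}=1$ (when $i\ge 3$), $a_{i,i-1}=i+1$, $a_{ij}=1$ for $i\le j\le m-1$, and $a_{im}=2$; last row $m$: $a_{mj}=0$ for $j\le m-2$, $a_{m,m-1}=1$, $a_{mm}=-4$. (E.g. for $N=7$: rows $(1,1,3),(3,1,2),(0,1,-4)$.) The Kurepa determinant is $K_N=\det M_N$. *)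

theory Defs
  imports "Jordan_Normal_Form.Determinant" "HOL-Number_Theory.Cong"
    "HOL-Computational_Algebra.Primes"
begin

text \<open>Entries are indexed from 1, for \<open>1 \<le> i, j \<le> m\<close>. The conditions \<open>j + 1 = i\<close> and
  \<open>j + 2 = i\<close> avoid truncated subtraction on the indices.\<close>

definition kurepa_entry :: "nat \<Rightarrow> nat \<Rightarrow> nat \<Rightarrow> int" where
  "kurepa_entry m i j =
    (if i = 1 then (if j = m then 3 else 1)
     else if i = m then
       (if j = m then -4 else if j + 1 = m then 1 else 0)
     else
       (if j = m then 2
        else if i \<le> j then 1
        else if j + 1 = i then int i + 1
        else if j + 2 = i then 1
        else 0))"

text \<open>Meaningful for \<open>N \<ge> 7\<close>; matrices of the library are indexed from 0.\<close>

definition kurepa_mat :: "nat \<Rightarrow> int mat" where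
  "kurepa_mat N = mat (N - 4) (N - 4) (\<lambda>(i, j). kurepa_entry (N - 4) (Suc i) (Suc j))"

definition kurepa_det :: "nat \<Rightarrow> int" where
  "kurepa_det N = det (kurepa_mat N)"

lemma kurepa_mat_7:
  "kurepa_mat 7 = mat_of_rows_list 3 [[1, 1, 3], [3, 1, 2], [0, 1, -4]]"
  by (rule eq_matI)
    (auto simp: kurepa_mat_def kurepa_entry_def mat_of_rows_list_def less_Suc_eq numeral_3_eq_3)

end

theory Submission
  imports Defs
begin

text \<open>An integer vector \<open>v\<close> with \<open>M v \<equiv> 0 (mod n)\<close> and an entry \<open>1\<close> forces \<open>n\<close> to divide
  \<open>det M\<close>, because \<open>adj M \<cdot> M = det M \<cdot> I\<close>. Modulo \<open>N\<close> one has \<open>m = N - 4 \<equiv> -4\<close>, and the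
  differences of consecutive rows of \<open>M\<^sub>N\<close> become a recurrence for the entries of \<open>v\<close>, read from
  the end of the vector. With \<open>v\<^sub>m = v\<^sub>m\<^sub>-\<^sub>1 = 0\<close> and \<open>v\<^sub>m\<^sub>-\<^sub>2 = 1\<close> it has the solution
  \<open>u k = v\<^sub>m\<^sub>-\<^sub>2\<^sub>-\<^sub>k = 1 + 3 (1 + 5 + 5 \<cdot> 6 + \<dots>)\<close> with \<open>k\<close> terms in the bracket, so that
  \<open>8 u k = 0! + 1! + \<dots> + (k + 3)! - 2\<close>. The first two rows hold as soon as \<open>u\<close> vanishes modulo
  \<open>N\<close> at the two indices beyond the beginning of the vector. For \<open>N = 11563 = 31 \<cdot> 373\<close> the terms
  of the bracket vanish modulo \<open>N\<close> from index \<open>369\<close> on, and so does \<open>u\<close>.\<close>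

lemma dvd_det_of_dvd_mult_vec:
  fixes A :: "'a :: comm_ring_1 mat"
  assumes A: "A \<in> carrier_mat m m" and v: "v \<in> carrier_vec m"
    and dvd: "\<And>i. i < m \<Longrightarrow> n dvd (A *\<^sub>v v) $ i"
    and j: "j < m" "v $ j = 1"
  shows "n dvd det A"
proof -
  note adj = adj_mat[OF A]
  have "adj_mat A *\<^sub>v (A *\<^sub>v v) = (det A \<cdot>\<^sub>m 1\<^sub>m m) *\<^sub>v v"
    using adj(1,3) A v by (metis assoc_mult_mat_vec)
  also have "\<dots> = det A \<cdot>\<^sub>v v"
    using v by auto
  finally have "(adj_mat A *\<^sub>v (A *\<^sub>v v)) $ j = det A"
    using v j by simp
  moreover have "n dvd (adj_mat A *\<^sub>v w) $ j"
    if "\<And>i. i < m \<Longrightarrow> n dvd w $ i" "dim_vec w = m" for w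
    using adj(1) j that by (auto simp: scalar_prod_def intro!: dvd_sum dvd_mult)
  then have "n dvd (adj_mat A *\<^sub>v (A *\<^sub>v v)) $ j"
    using A dvd by auto
  ultimately show ?thesis by simp
qed

definition null_entry :: "nat \<Rightarrow> int" where
  "null_entry k = 1 + 3 * (\<Sum>j<k. pochhammer 5 j)"

lemma null_entry_0 [simp]: "null_entry 0 = 1"
  by (simp add: null_entry_def)

lemma null_entry_Suc: "null_entry (Suc k) = null_entry k + 3 * pochhammer 5 k"
  by (simp add: null_entry_def)

text \<open>The induction step is the recurrence
  \<open>u (K + 3) - u (K + 2) = (K + 6) (u (K + 2) - u (K + 1))\<close> for
  \<open>u = null_entry\<close>, inherited from \<open>pochhammer_Suc\<close>.\<close>

lemma sum_null_entry:
  "(\<Sum>k\<le>K. null_entry k) = (5 + int K) * null_entry (Suc K) - null_entry (Suc (Suc K))"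
  by (induction K) (simp_all add: null_entry_Suc pochhammer_Suc algebra_simps)

text \<open>Indices start at 1. The zeros at \<open>m - 1\<close> and \<open>m\<close> annihilate
  the last row and the exceptional entries 3 and 2 of column \<open>m\<close>.\<close>

definition null_vec :: "nat \<Rightarrow> nat \<Rightarrow> int" where
  "null_vec m j = (if j + 2 \<le> m then null_entry (m - 2 - j) else 0)"

lemma sum_null_vec:
  assumes "1 \<le> i" "i + 2 \<le> m"
  shows "(\<Sum>j=i..m. null_vec m j) =
    (5 + int (m - 2 - i)) * null_entry (m - 1 - i) - null_entry (m - i)"
proof -
  have "(\<Sum>j=i..m. null_vec m j) = (\<Sum>j=i..m-2. null_entry (m - 2 - j))"
    using assms by (intro sum.mono_neutral_cong_right) (auto simp: null_vec_def)
  also have "\<dots> = (\<Sum>k\<le>m-2-i. null_entry k)"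
    by (rule sum.reindex_bij_witness[of _ "\<lambda>k. m - 2 - k" "\<lambda>j. m - 2 - j"]) (use assms in auto)
  also have "\<dots> = (5 + int (m - 2 - i)) * null_entry (m - 1 - i) - null_entry (m - i)"
    using assms by (simp add: sum_null_entry Suc_diff_Suc numeral_2_eq_2)
  finally show ?thesis .
qed

lemma kurepa_row_first:
  assumes "3 \<le> m"
  shows "(\<Sum>j=1..m. kurepa_entry m 1 j * null_vec m j) =
    (int m + 2) * null_entry (m - 2) - null_entry (m - 1)"
proof -
  have "(\<Sum>j=1..m. kurepa_entry m 1 j * null_vec m j) = (\<Sum>j=1..m. null_vec m j)"
    by (intro sum.cong) (auto simp: kurepa_entry_def null_vec_def)
  then show ?thesis
    using assms by (simp add: sum_null_vec of_nat_diff numeral_2_eq_2)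
qed

lemma kurepa_row_last:
  assumes "3 \<le> m"
  shows "(\<Sum>j=1..m. kurepa_entry m m j * null_vec m j) = 0"
  using assms by (intro sum.neutral) (auto simp: kurepa_entry_def null_vec_def)

lemma kurepa_row_middle:
  assumes "3 \<le> m" "2 \<le> i" "i < m"
  shows "(\<Sum>j=1..m. kurepa_entry m i j * null_vec m j) =
    (if i = 2 then 0 else null_vec m (i - 2)) + (int i + 1) * null_vec m (i - 1)
      + (\<Sum>j=i..m. null_vec m j)"
proof -
  let ?f = "\<lambda>j. kurepa_entry m i j * null_vec m j"
  \<comment> \<open>For \<open>i = 2\<close> the index \<open>i - 2\<close> is 0, which is no
    column; removing 0 lets one decomposition serve every \<open>i\<close>.\<close>
  have "{1..m} = {1..<i-2} \<union> ({i-2,i-1} - {0}) \<union> {i..m}"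
    using assms by auto
  then have "(\<Sum>j=1..m. ?f j) =
      (\<Sum>j\<in>{1..<i-2}. ?f j) + (\<Sum>j\<in>{i-2,i-1} - {0}. ?f j) + (\<Sum>j=i..m. ?f j)"
    using assms by (simp only:) (subst sum.union_disjoint; auto)+
  moreover have "(\<Sum>j\<in>{1..<i-2}. ?f j) = 0"
    using assms by (intro sum.neutral) (auto simp: kurepa_entry_def)
  moreover have "(\<Sum>j=i..m. ?f j) = (\<Sum>j=i..m. null_vec m j)"
    using assms by (intro sum.cong) (auto simp: kurepa_entry_def null_vec_def)
  moreover have "(\<Sum>j\<in>{i-2,i-1} - {0}. ?f j) =
      (if i = 2 then 0 else null_vec m (i - 2)) + (int i + 1) * null_vec m (i - 1)"
  proof (cases "i = 2")
    case True
    then have "{i-2,i-1} - {0} = {1}" by auto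
    with True assms show ?thesis by (simp add: kurepa_entry_def)
  next
    case False
    then have "{i-2,i-1} - {0} = {i-2,i-1}" "i - 2 \<noteq> i - 1"
      "kurepa_entry m i (i - 2) = 1" "kurepa_entry m i (i - 1) = int i + 1"
      using assms by (auto simp: kurepa_entry_def)
    with False show ?thesis by simp
  qed
  ultimately show ?thesis by simp
qed

lemma kurepa_row_dvd:
  assumes m: "4 \<le> m" and i: "1 \<le> i" "i \<le> m"
    and dvd: "int m + 4 dvd null_entry (m - 2)" "int m + 4 dvd null_entry (m - 1)"
  shows "int m + 4 dvd (\<Sum>j=1..m. kurepa_entry m i j * null_vec m j)"
proof -
  consider "i = 1" | "i = m" | "i = m - 1" "2 \<le> i" | "2 \<le> i" "i + 2 \<le> m"
    using i by linarith
  then show ?thesis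
  proof cases
    case 1
    then show ?thesis using dvd m unfolding 1 by (subst kurepa_row_first) auto
  next
    case 2
    then show ?thesis using kurepa_row_last[of m] m by simp
  next
    case 3
    \<comment> \<open>Only the two subdiagonal entries meet nonzero values here: the row gives
      \<open>4 + m * 1\<close>. As \<open>4 \<le> m\<close>, this is not row 2.\<close>
    have "(\<Sum>j=i..m. null_vec m j) = 0"
      using 3 by (intro sum.neutral) (auto simp: null_vec_def)
    moreover have "null_vec m (i - 1) = 1"
      using 3 m by (simp add: null_vec_def numeral_2_eq_2)
    moreover have "m - 2 - (i - 2) = Suc 0" "i - 2 + 2 \<le> m" "i \<noteq> 2"
      using 3 m by auto
    then have "null_vec m (i - 2) = 4"
      by (simp add: null_vec_def null_entry_Suc)
    ultimately have "(\<Sum>j=1..m. kurepa_entry m i j * null_vec m j) = int m + 4"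
      using 3 m by (subst kurepa_row_middle) (auto simp: of_nat_diff)
    then show ?thesis by simp
  next
    case 4
    \<comment> \<open>The tail sum contributes \<open>- null_entry (K + 2)\<close>, which cancels
      against column \<open>i - 2\<close>; what remains has the factor
      \<open>(i + 1) + (5 + K) = m + 4\<close>. Row 2 lacks that column, so
      \<open>null_entry (m - 2)\<close> survives.\<close>
    define K where "K = m - 2 - i"
    have mK: "m = K + i + 2" using 4 by (simp add: K_def)
    have a: "null_vec m (i - 1) = null_entry (Suc K)"
      using 4 by (simp add: null_vec_def mK Suc_diff_le)
    have s: "(\<Sum>j=i..m. null_vec m j) =
        (5 + int K) * null_entry (Suc K) - null_entry (Suc (Suc K))"
      using sum_null_vec[of i m] 4 by (simp add: mK)
    show ?thesis
    proof (cases "i = 2")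
      case True
      have "(\<Sum>j=1..m. kurepa_entry m i j * null_vec m j) =
          (int m + 4) * null_entry (Suc K) - null_entry (m - 2)"
        using kurepa_row_middle[of m i] 4 m True unfolding a s by (simp add: mK algebra_simps)
      then show ?thesis using dvd by simp
    next
      case False
      have b: "null_vec m (i - 2) = null_entry (Suc (Suc K))"
        using 4 by (simp add: null_vec_def mK Suc_diff_le)
      have "(\<Sum>j=1..m. kurepa_entry m i j * null_vec m j) = (int m + 4) * null_entry (Suc K)"
        using kurepa_row_middle[of m i] 4 m False unfolding a b s by (simp add: mK algebra_simps)
      then show ?thesis by simp
    qed
  qed
qed

theorem dvd_kurepa_det:
  assumes N: "8 \<le> N" and dvd: "int N dvd null_entry (N - 6)" "int N dvd null_entry (N - 5)"
  shows "int N dvd kurepa_det N"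
  unfolding kurepa_det_def
proof (rule dvd_det_of_dvd_mult_vec)
  define m where "m = N - 4"
  have m: "4 \<le> m" "int m + 4 = int N" "m - 2 = N - 6" "m - 1 = N - 5"
    using N by (auto simp: m_def)
  let ?v = "vec m (\<lambda>j. null_vec m (Suc j))"
  show M: "kurepa_mat N \<in> carrier_mat m m" by (simp add: kurepa_mat_def m_def)
  show "?v \<in> carrier_vec m" by simp
  \<comment> \<open>Position \<open>m - 3\<close> counted from 0 is index \<open>m - 2\<close>,
    where the entry is \<open>null_entry 0\<close>.\<close>
  show "m - 3 < m" "?v $ (m - 3) = 1"
    using m(1) by (auto simp: null_vec_def Suc_diff_le numeral_3_eq_3 numeral_2_eq_2)
  fix i assume i: "i < m"
  have "(kurepa_mat N *\<^sub>v ?v) $ i =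
      (\<Sum>j=0..<m. kurepa_entry m (Suc i) (Suc j) * null_vec m (Suc j))"
    using i by (simp add: kurepa_mat_def m_def[symmetric] scalar_prod_def)
  also have "\<dots> = (\<Sum>j=1..m. kurepa_entry m (Suc i) j * null_vec m j)"
    by (rule sum.reindex_bij_witness[of _ "\<lambda>j. j - 1" Suc]) auto
  finally show "int N dvd (kurepa_mat N *\<^sub>v ?v) $ i"
    using kurepa_row_dvd[of m "Suc i"] m dvd i by simp
qed

definition null_step :: "int \<Rightarrow> int \<times> int \<times> int \<Rightarrow> int \<times> int \<times> int" where
  "null_step n = (\<lambda>(a, p, u). (a + 1, p * a mod n, (u + 3 * p) mod n))"

text \<open>The start \<open>(5, 1, 1)\<close> is not reduced, and \<open>1 mod n\<close> differs
  from 1 for \<open>n = 1\<close>; hence the invariant is stated after at least one step.\<close>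

lemma null_step_funpow:
  "(null_step n ^^ Suc k) (5, 1, 1) =
    (5 + int (Suc k), pochhammer 5 (Suc k) mod n, null_entry (Suc k) mod n)"
proof (induction k)
  case 0
  show ?case by (simp add: null_step_def null_entry_Suc)
next
  case (Suc k)
  have "pochhammer 5 (Suc k) mod n * (5 + int (Suc k)) mod n = pochhammer 5 (Suc (Suc k)) mod n"
    by (simp only: mod_mult_left_eq pochhammer_Suc[of _ "Suc k"])
  moreover have "(null_entry (Suc k) mod n + 3 * (pochhammer 5 (Suc k) mod n)) mod n =
      null_entry (Suc (Suc k)) mod n"
    unfolding null_entry_Suc[of "Suc k"] by (intro mod_add_cong mod_mult_cong mod_mod_trivial refl)
  moreover have "5 + int (Suc k) + 1 = 5 + int (Suc (Suc k))"
    by simp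
  moreover have "(null_step n ^^ Suc (Suc k)) (5, 1, 1) =
      null_step n ((null_step n ^^ Suc k) (5, 1, 1))"
    by simp
  ultimately show ?case
    unfolding Suc by (simp only: null_step_def prod.case)
qed

text \<open>369 is the least index at which the product \<open>5 * 6 * ...\<close> has reached the
  factor 373, having passed 31 before.\<close>

lemma null_step_funpow_11563: "(null_step 11563 ^^ 369) (5, 1, 1) = (374, 0, 0)"
  by code_simp

text \<open>Once the product vanishes modulo 11563, it stays zero and \<open>null_entry\<close>
  stays constant, so the residues at 369 settle the indices 11557 and 11558.\<close>

lemma dvd_pochhammer_null_entry_11563:
  assumes "369 \<le> k"
  shows "11563 dvd (pochhammer 5 k :: int) \<and> 11563 dvd null_entry k"
  using assms
proof (induction k rule: dec_induct)
  case base
  have "369 = Suc 368" by simp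
  then have "(5 + int 369, (pochhammer 5 369 :: int) mod 11563, null_entry 369 mod 11563) =
      (374, 0, 0)"
    using null_step_funpow[where n = 11563 and k = 368] null_step_funpow_11563 by metis
  then show ?case by (metis prod.inject dvd_eq_mod_eq_0)
next
  case (step k)
  then show ?case by (simp add: pochhammer_Suc null_entry_Suc)
qed

theorem theorem3:
  shows "(11563::nat) = 31 * 373 \<and> [kurepa_det 11563 = 0] (mod 11563) \<and>
    (\<exists>n::nat. odd n \<and> \<not> prime n \<and> n \<ge> 9 \<and> [kurepa_det n = 0] (mod int n))"
proof -
  have factor: "(11563::nat) = 31 * 373" by simp
  have "int 11563 dvd kurepa_det 11563"
    by (rule dvd_kurepa_det) (simp_all add: dvd_pochhammer_null_entry_11563)
  then have cong: "[kurepa_det 11563 = 0] (mod int 11563)"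
    by (simp only: cong_0_iff)
  have "\<not> prime (11563::nat)"
  proof
    assume "prime (11563::nat)"
    from prime_product[OF this[unfolded factor]] show False by simp
  qed
  moreover have "odd (11563::nat)" "(11563::nat) \<ge> 9" by simp_all
  ultimately have "\<exists>n::nat. odd n \<and> \<not> prime n \<and> n \<ge> 9 \<and> [kurepa_det n = 0] (mod int n)"
    using cong by blast
  moreover have "[kurepa_det 11563 = 0] (mod 11563)"
    using cong by simp
  ultimately show ?thesis
    using factor by blast
qed

end
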